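(* Let $F=U/\Gamma$ be a compact Riemann surface of genus $g\ge2$, $d=3g-3$, let $r(t)\,dt^2$ be a holomorphic quadratic differential on $F$ and let $q_1(t)\,dt^2,\dots,q_d(t)\,dt^2$ be a basis of the space $Q(F)$ of holomorphic quadratic differentials on $F$. For $h=(h_1,\dots,h_d)\in\mathbf{C}^d$ with $|h|=\max_{1\le j\le d}|h_j|<\varepsilon$, where $\varepsilon$ is a sufficiently small positive number, let $z(t,h)$ be the solution on $U$ of the Schwarz equation $$\{z,t\}=2\Big[r(t)+\sum_{j=1}^d h_jq_j(t)\Big]$$ normalized by $z(t,h)=(t-t_0)+O((t-t_0)^3)$, $\sqrt{z'(t,h)}=1+O((t-t_0)^2)$ as $t\to t_0$. Then for $h=(h_1,\dots,h_d)$, $|h|<\varepsilon$, the following variational formula is valid: $$z(t,h)=z(t,0)+\sum_{i=1}^dh_i\int_{t_0}^tq_i(s)\big(v(s)-z(t,0)u(s)\big)^2ds+o(|h|),\qquad |h|\to0.$$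
   Context: $U=\{t\in\mathbf{C}:|t|<1\}$; $\Gamma$ is the Fuchsian group of covering transformations of the universal covering $U\to F$; $t_0\in U$ is a fixed point. Holomorphic quadratic differentials on $F$ are identified with holomorphic functions $q$ on $U$ with $q(Lt)L'(t)^2=q(t)$ for $L\in\Gamma$. The Schwarzian derivative is $\{z,t\}=(z''/z')'-\tfrac12(z''/z')^2$, where primes denote derivatives in $t$. $u(t,h),v(t,h)$ denote the solutions on $U$ of the linear equation $y''+[r(t)+\sum_{j=1}^dh_jq_j(t)]\,y=0$ with $u(t_0,h)=1$, $u'(t_0,h)=0$, $v(t_0,h)=0$, $v'(t_0,h)=1$; then $z(t,h)=v(t,h)/u(t,h)$. Write $u(s)=u(s,0)$, $v(s)=v(s,0)$. In the integral, $s$ is the variable of integration, running from $t_0$ to $t$ in $U$, and $z(t,0)$ does not depend on $s$. *)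

theory Defs
  imports
    "HOL-Complex_Analysis.Complex_Analysis"
    "HOL-Homology.Homology"
    "HOL-Algebra.Bij"
    "HOL-Library.Function_Algebras"
    "HOL-Library.Landau_Symbols"
begin

abbreviation unit_disk :: "complex set" where
  "unit_disk \<equiv> ball 0 1"


section \<open>Fuchsian groups and their orbit spaces\<close>

text \<open>Elements of a Fuchsian group are extensional functions (undefined off the disk),
  multiplied by composition, so that distinct elements differ on the disk. A bijective holomorphic
  self-map of the disk is biholomorphic; discreteness is expressed as proper discontinuity.\<close>

definition fuchsian_group :: "(complex \<Rightarrow> complex) set \<Rightarrow> bool" where
  "fuchsian_group \<Gamma> \<longleftrightarrow>
     subgroup \<Gamma> (BijGroup unit_disk) \<and>
     (\<forall>L\<in>\<Gamma>. L holomorphic_on unit_disk) \<and>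
     (\<forall>K. compact K \<and> K \<subseteq> unit_disk \<longrightarrow> finite {L\<in>\<Gamma>. L ` K \<inter> K \<noteq> {}})"

text \<open>A Fuchsian group is the covering group of the projection of the disk onto its orbit space
  exactly if no element other than the identity has a fixed point.\<close>

definition acts_freely :: "(complex \<Rightarrow> complex) set \<Rightarrow> bool" where
  "acts_freely \<Gamma> \<longleftrightarrow>
     (\<forall>L\<in>\<Gamma>. (\<exists>t\<in>unit_disk. L t = t) \<longrightarrow> L = \<one>\<^bsub>BijGroup unit_disk\<^esub>)"

definition orbit_of :: "(complex \<Rightarrow> complex) set \<Rightarrow> complex \<Rightarrow> complex set" where
  "orbit_of \<Gamma> t = {L t | L. L \<in> \<Gamma>}"

definition orbit_space :: "(complex \<Rightarrow> complex) set \<Rightarrow> complex set topology" where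
  "orbit_space \<Gamma> = topology (\<lambda>V. V \<subseteq> orbit_of \<Gamma> ` unit_disk \<and>
     openin (top_of_set unit_disk) {t\<in>unit_disk. orbit_of \<Gamma> t \<in> V})"

lemma openin_orbit_space:
  "openin (orbit_space \<Gamma>) V \<longleftrightarrow> V \<subseteq> orbit_of \<Gamma> ` unit_disk \<and>
     openin (top_of_set unit_disk) {t\<in>unit_disk. orbit_of \<Gamma> t \<in> V}"
proof -
  have "istopology (\<lambda>V. V \<subseteq> orbit_of \<Gamma> ` unit_disk \<and>
     openin (top_of_set unit_disk) {t\<in>unit_disk. orbit_of \<Gamma> t \<in> V})"
    unfolding istopology_def
  proof (rule conjI; clarify)
    fix S T
    assume "openin (top_of_set unit_disk) {t\<in>unit_disk. orbit_of \<Gamma> t \<in> S}"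
      and "openin (top_of_set unit_disk) {t\<in>unit_disk. orbit_of \<Gamma> t \<in> T}"
      and S: "S \<subseteq> orbit_of \<Gamma> ` unit_disk"
    then have "openin (top_of_set unit_disk)
        ({t\<in>unit_disk. orbit_of \<Gamma> t \<in> S} \<inter> {t\<in>unit_disk. orbit_of \<Gamma> t \<in> T})"
      by blast
    moreover have "{t\<in>unit_disk. orbit_of \<Gamma> t \<in> S} \<inter> {t\<in>unit_disk. orbit_of \<Gamma> t \<in> T} =
        {t\<in>unit_disk. orbit_of \<Gamma> t \<in> S \<inter> T}"
      by blast
    ultimately show "S \<inter> T \<subseteq> orbit_of \<Gamma> ` unit_disk \<and>
        openin (top_of_set unit_disk) {t\<in>unit_disk. orbit_of \<Gamma> t \<in> S \<inter> T}"
      using S by auto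
  next
    fix \<K>
    assume K: "\<forall>K\<in>\<K>. K \<subseteq> orbit_of \<Gamma> ` unit_disk \<and>
        openin (top_of_set unit_disk) {t\<in>unit_disk. orbit_of \<Gamma> t \<in> K}"
    then have "openin (top_of_set unit_disk)
        (\<Union>K\<in>\<K>. {t\<in>unit_disk. orbit_of \<Gamma> t \<in> K})"
      by blast
    moreover have "(\<Union>K\<in>\<K>. {t\<in>unit_disk. orbit_of \<Gamma> t \<in> K}) =
        {t\<in>unit_disk. orbit_of \<Gamma> t \<in> \<Union>\<K>}"
      by blast
    ultimately show "\<Union>\<K> \<subseteq> orbit_of \<Gamma> ` unit_disk \<and>
        openin (top_of_set unit_disk) {t\<in>unit_disk. orbit_of \<Gamma> t \<in> \<Union>\<K>}"
      using K by auto
  qed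
  then show ?thesis
    by (simp add: orbit_space_def)
qed

lemma topspace_orbit_space: "topspace (orbit_space \<Gamma>) = orbit_of \<Gamma> ` unit_disk"
proof -
  have "{t\<in>unit_disk. orbit_of \<Gamma> t \<in> orbit_of \<Gamma> ` unit_disk} = unit_disk"
    by blast
  then have "openin (orbit_space \<Gamma>) (orbit_of \<Gamma> ` unit_disk)"
    unfolding openin_orbit_space by (metis openin_subtopology_self subset_refl)
  then show ?thesis
    by (meson openin_orbit_space openin_subset openin_topspace subset_antisym)
qed

lemma quotient_map_orbit_of:
  "quotient_map (top_of_set unit_disk) (orbit_space \<Gamma>) (orbit_of \<Gamma>)"
  by (auto simp: quotient_map_def topspace_orbit_space openin_orbit_space)

text \<open>The topological genus of a compact connected orientable surface: its first integral
  homology group is free abelian of rank twice the genus.\<close>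

definition has_genus :: "'a topology \<Rightarrow> nat \<Rightarrow> bool" where
  "has_genus X g \<longleftrightarrow> homology_group 1 X \<cong> free_Abelian_group {..<2 * g}"


section \<open>Holomorphic quadratic differentials\<close>

text \<open>Functions on the disk are extended by zero, so that equality on the disk is equality
  of functions and the quadratic differentials form a linear subspace of
  \<^typ>\<open>complex \<Rightarrow> complex\<close>.\<close>

definition quadratic_differentials :: "(complex \<Rightarrow> complex) set \<Rightarrow> (complex \<Rightarrow> complex) set" where
  "quadratic_differentials \<Gamma> =
     {q. q holomorphic_on unit_disk \<and>
         (\<forall>L\<in>\<Gamma>. \<forall>t\<in>unit_disk. q (L t) * (deriv L t)\<^sup>2 = q t) \<and>
         (\<forall>t. t \<notin> unit_disk \<longrightarrow> q t = 0)}"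

interpretation cfun: vector_space "\<lambda>(c::complex) (f::complex \<Rightarrow> complex) t. c * f t"
  by unfold_locales (auto simp: fun_eq_iff algebra_simps)

lemma subspace_quadratic_differentials: "cfun.subspace (quadratic_differentials \<Gamma>)"
  unfolding cfun.subspace_def quadratic_differentials_def
  by (auto simp: zero_fun_def plus_fun_def algebra_simps intro!: holomorphic_intros)

definition qd_basis :: "(complex \<Rightarrow> complex) set \<Rightarrow> ('d \<Rightarrow> complex \<Rightarrow> complex) \<Rightarrow> bool" where
  "qd_basis \<Gamma> q \<longleftrightarrow>
     inj q \<and> cfun.independent (range q) \<and> cfun.span (range q) = quadratic_differentials \<Gamma>"


section \<open>The Schwarz equation and the associated linear equation\<close>

definition maxnorm :: "complex ^ 'd \<Rightarrow> real" where
  "maxnorm h = Max (range (\<lambda>j. cmod (h $ j)))"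

definition potential ::
    "(complex \<Rightarrow> complex) \<Rightarrow> ('d::finite \<Rightarrow> complex \<Rightarrow> complex) \<Rightarrow> complex ^ 'd \<Rightarrow> complex \<Rightarrow> complex"
  where "potential r q h t = r t + (\<Sum>j\<in>UNIV. h $ j * q j t)"

definition schwarzian :: "(complex \<Rightarrow> complex) \<Rightarrow> complex \<Rightarrow> complex" where
  "schwarzian z t =
     deriv (\<lambda>s. deriv (deriv z) s / deriv z s) t - 1 / 2 * (deriv (deriv z) t / deriv z t)\<^sup>2"

text \<open>Solutions of \<open>{z,t} = 2 p(t)\<close> are meromorphic on the disk. The nonvanishing of the derivative
  makes the Schwarzian well defined; at poles, the equation is understood by continuity.\<close>

definition schwarz_solution :: "(complex \<Rightarrow> complex) \<Rightarrow> (complex \<Rightarrow> complex) \<Rightarrow> bool" where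
  "schwarz_solution p z \<longleftrightarrow>
     z nicely_meromorphic_on unit_disk \<and>
     (\<forall>t\<in>unit_disk. \<not> is_pole z t \<longrightarrow> deriv z t \<noteq> 0 \<and> schwarzian z t = 2 * p t)"

text \<open>As \<open>z'(t)\<close> tends to 1 for \<open>t \<rightarrow> t\<^sub>0\<close>, the principal branch is the branch of the root
  which tends to 1.\<close>

definition schwarz_normalized :: "complex \<Rightarrow> (complex \<Rightarrow> complex) \<Rightarrow> bool" where
  "schwarz_normalized t\<^sub>0 z \<longleftrightarrow>
     (\<lambda>t. z t - (t - t\<^sub>0)) \<in> O[at t\<^sub>0](\<lambda>t. (t - t\<^sub>0) ^ 3) \<and>
     (\<lambda>t. csqrt (deriv z t) - 1) \<in> O[at t\<^sub>0](\<lambda>t. (t - t\<^sub>0) ^ 2)"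

definition linear_solution :: "(complex \<Rightarrow> complex) \<Rightarrow> (complex \<Rightarrow> complex) \<Rightarrow> bool" where
  "linear_solution p y \<longleftrightarrow>
     y holomorphic_on unit_disk \<and> (\<forall>t\<in>unit_disk. deriv (deriv y) t + p t * y t = 0)"

end

theory Submission
  imports Defs
begin

text \<open>On a disk that contains \<open>t\<^sub>0\<close> and \<open>t\<close> and is relatively compact in the unit disk, variation of
  constants expresses the solutions of the perturbed linear equation through \<open>u\<close> and \<open>v\<close> by an integral
  operator of norm \<open>O(|h|)\<close>. Its Neumann series yields solutions \<open>U\<close>, \<open>V\<close> of the perturbed equation
  together with their first-order expansions. The normalization fixes the jet of order two of \<open>z(\<cdot>,h)\<close>
  at \<open>t\<^sub>0\<close>, and Riccati uniqueness with analytic continuation off the poles gives \<open>z(t,h) = V(t) / U(t)\<close>.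
  Expanding this quotient to first order and using that the integral operator is bilinear in \<open>u\<close>
  and \<open>v\<close> gives the formula, even with remainder \<open>O(|h|\<^sup>2)\<close>.\<close>

section \<open>Neumann series for contractions on bounded holomorphic functions\<close>

text \<open>The iterates of \<open>S\<close> on \<open>f\<close> are dominated by the geometric
  series \<open>c ^ n * N\<close>, so the Weierstrass test gives uniform convergence on
  \<open>B\<close>. A uniform limit of holomorphic functions is holomorphic, and the sum of the
  majorant is the stated bound.\<close>

lemma holomorphic_neumann_series:
  fixes S :: "(complex \<Rightarrow> complex) \<Rightarrow> complex \<Rightarrow> complex"
  assumes B: "open B"
    and hol: "\<And>f. f holomorphic_on B \<Longrightarrow> S f holomorphic_on B"
    and add: "\<And>f g t. f holomorphic_on B \<Longrightarrow> g holomorphic_on B \<Longrightarrow> t \<in> B \<Longrightarrow>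
      S (\<lambda>s. f s + g s) t = S f t + S g t"
    and bound: "\<And>f N t. f holomorphic_on B \<Longrightarrow> (\<And>s. s \<in> B \<Longrightarrow> cmod (f s) \<le> N) \<Longrightarrow> t \<in> B \<Longrightarrow>
      cmod (S f t) \<le> c * N"
    and c: "0 \<le> c" "c < 1"
    and f: "f holomorphic_on B" "\<And>s. s \<in> B \<Longrightarrow> cmod (f s) \<le> N"
  obtains y where "y holomorphic_on B" "\<And>t. t \<in> B \<Longrightarrow> y t = f t + S y t"
    "\<And>t. t \<in> B \<Longrightarrow> cmod (y t) \<le> N / (1 - c)"
proof -
  define Y where "Y n = (S ^^ n) f" for n
  define part where "part n = (\<lambda>t. \<Sum>k<n. Y k t)" for n
  define y where "y = (\<lambda>t. suminf (\<lambda>k. Y k t))"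
  have holY: "Y n holomorphic_on B" for n
    by (induction n) (auto simp: Y_def f(1) hol)
  have bY: "cmod (Y n t) \<le> c ^ n * N" if "t \<in> B" for n t
    using that
  proof (induction n arbitrary: t)
    case 0
    then show ?case using f(2) by (simp add: Y_def)
  next
    case (Suc n)
    then show ?case
      using bound[OF holY Suc.IH] by (simp add: Y_def mult.assoc)
  qed
  have sumM: "(\<lambda>n. c ^ n * N) sums (N / (1 - c))"
    using sums_mult2[OF geometric_sums[of c], of N] c by simp
  have lim: "uniform_limit B part y sequentially"
    unfolding part_def y_def
    by (rule Weierstrass_m_test[OF bY sums_summable[OF sumM]])
  have holp: "part n holomorphic_on B" for n
    unfolding part_def by (intro holomorphic_intros holY)
  have holy: "y holomorphic_on B"
  proof (rule holomorphic_uniform_sequence[OF B holp])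
    fix x assume "x \<in> B"
    then obtain d where "0 < d" "cball x d \<subseteq> B"
      using B open_contains_cball by blast
    then show "\<exists>d. 0 < d \<and> cball x d \<subseteq> B \<and> uniform_limit (cball x d) part y sequentially"
      using uniform_limit_on_subset[OF lim] by blast
  qed
  have Spart: "S (part n) t = part (Suc n) t - f t" if "t \<in> B" for n t
  proof (induction n)
    case 0
    \<comment> \<open>\<open>part 0\<close> is the zero function, and additivity gives
      \<open>x = x + x\<close> for its image \<open>x\<close>, hence \<open>x = 0\<close>.\<close>
    have "S (part 0) t = S (\<lambda>s. part 0 s + part 0 s) t"
      by (simp add: part_def)
    also have "\<dots> = S (part 0) t + S (part 0) t"
      by (rule add[OF holp holp that])
    finally show ?case
      by (simp add: part_def Y_def)
  next
    case (Suc n)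
    have "S (part (Suc n)) t = S (\<lambda>s. part n s + Y n s) t"
      by (simp add: part_def)
    also have "\<dots> = S (part n) t + S (Y n) t"
      by (rule add[OF holp holY that])
    finally show ?case
      using Suc.IH by (simp add: part_def Y_def)
  qed
  have fix_pt: "y t = f t + S y t" if t: "t \<in> B" for t
  proof -
    have pt: "(\<lambda>n. part n t) \<longlonglongrightarrow> y t"
      by (rule tendsto_uniform_limitI[OF lim t])
    have "(\<lambda>n. S (part n) t) \<longlonglongrightarrow> S y t"
    proof (rule LIMSEQ_I)
      fix e :: real assume "e > 0"
      then have "\<forall>\<^sub>F n in sequentially. \<forall>s\<in>B. dist (part n s) (y s) < e"
        using lim by (auto simp: uniform_limit_iff)
      then obtain n0 where n0: "\<And>n s. n \<ge> n0 \<Longrightarrow> s \<in> B \<Longrightarrow> dist (part n s) (y s) < e"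
        by (auto simp: eventually_sequentially)
      have "cmod (S (part n) t - S y t) < e" if "n \<ge> n0" for n
      proof -
        \<comment> \<open>Splitting off the error \<open>part n - y\<close> and applying the sup
          bound to it shows that \<open>S\<close> respects uniform convergence. The strict
          inequality at the end comes from \<open>c < 1\<close>.\<close>
        have "S (part n) t = S (\<lambda>s. y s + (part n s - y s)) t"
          by simp
        also have "\<dots> = S y t + S (\<lambda>s. part n s - y s) t"
          by (rule add) (auto intro!: holomorphic_intros holy holp t)
        finally have "S (part n) t - S y t = S (\<lambda>s. part n s - y s) t"
          by simp
        also have "cmod \<dots> \<le> c * e"
          by (rule bound) (use n0[OF that] in \<open>auto intro!: holomorphic_intros holy holp t
                simp: dist_norm less_imp_le\<close>)
        also have "\<dots> < e"
          using c \<open>e > 0\<close> by simp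
        finally show ?thesis .
      qed
      then show "\<exists>n0. \<forall>n\<ge>n0. cmod (S (part n) t - S y t) < e"
        by blast
    qed
    moreover have "(\<lambda>n. S (part n) t) \<longlonglongrightarrow> y t - f t"
      unfolding Spart[OF t] by (intro tendsto_intros LIMSEQ_Suc[OF pt])
    ultimately show ?thesis
      using LIMSEQ_unique by fastforce
  qed
  have "cmod (y t) \<le> N / (1 - c)" if "t \<in> B" for t
    using norm_suminf_le[OF bY[OF that] sums_summable[OF sumM]] sums_unique[OF sumM]
    by (simp add: y_def)
  then show ?thesis
    using that holy fix_pt by blast
qed

section \<open>Primitives along segments in convex sets\<close>

lemma contour_integrable_linepath_holomorphic:
  assumes "convex B" "f holomorphic_on B" "a \<in> B" "b \<in> B"
  shows "f contour_integrable_on (linepath a b)"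
  using assms
  by (meson closed_segment_subset contour_integrable_continuous_linepath
      holomorphic_on_imp_continuous_on holomorphic_on_subset)

text \<open>By convexity every triangle with vertex \<open>a\<close> lies in \<open>B\<close>, so
  Cauchy's theorem makes its boundary integral vanish; this is the criterion for the integral from
  \<open>a\<close> to be a primitive.\<close>

lemma linepath_primitive:
  assumes B: "open B" "convex B" and f: "f holomorphic_on B" and a: "a \<in> B" and t: "t \<in> B"
  shows "((\<lambda>t. contour_integral (linepath a t) f) has_field_derivative f t) (at t)"
proof -
  have zero: "contour_integral (linepath a b) f + contour_integral (linepath b c) f +
      contour_integral (linepath c a) f = 0" if "b \<in> B" "c \<in> B" for b c
  proof (rule has_chain_integral_chain_integral3)
    have "closed_segment a b \<union> (closed_segment b c \<union> closed_segment c a) \<subseteq> B"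
      using that a B by (simp add: closed_segment_subset)
    then show "(f has_contour_integral 0) (linepath a b +++ linepath b c +++ linepath c a)"
      by (intro Cauchy_theorem_convex_simple[OF f B(2)]) (auto simp: path_image_join)
  qed
  then have "((\<lambda>t. contour_integral (linepath a t) f) has_field_derivative f t) (at t within B)"
    using triangle_contour_integrals_convex_primitive[OF holomorphic_on_imp_continuous_on[OF f] a B(2) t]
    by blast
  then show ?thesis
    using at_within_open[OF t B(1)] by simp
qed

section \<open>Fundamental systems and variation of constants\<close>

text \<open>The potential \<open>p\<close> is a parameter, so that the results apply both to the
  unperturbed pair \<open>u\<close>, \<open>v\<close> and to the perturbed pair constructed from
  it.\<close>

locale fundamental_system =
  fixes B :: "complex set" and t\<^sub>0 :: complex and p u v :: "complex \<Rightarrow> complex"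
  assumes B: "open B" "convex B" "t\<^sub>0 \<in> B"
    and hol: "u holomorphic_on B" "v holomorphic_on B"
    and ode_u: "\<And>t. t \<in> B \<Longrightarrow> deriv (deriv u) t + p t * u t = 0"
    and ode_v: "\<And>t. t \<in> B \<Longrightarrow> deriv (deriv v) t + p t * v t = 0"
    and init: "u t\<^sub>0 = 1" "deriv u t\<^sub>0 = 0" "v t\<^sub>0 = 0" "deriv v t\<^sub>0 = 1"
begin

lemma deriv_at:
  assumes "f holomorphic_on B" "t \<in> B"
  shows "(f has_field_derivative deriv f t) (at t)"
  using assms B(1) holomorphic_derivI by blast

lemma deriv2_at:
  assumes "f holomorphic_on B" "t \<in> B"
  shows "(deriv f has_field_derivative deriv (deriv f) t) (at t)"
  using deriv_at[OF holomorphic_deriv[OF assms(1) B(1)] assms(2)] .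

text \<open>The equation has no first-order term, so the derivative \<open>u v'' - u'' v\<close>
  cancels and the Wronskian keeps its value at \<open>t\<^sub>0\<close>.\<close>

lemma wronskian:
  assumes t: "t \<in> B"
  shows "u t * deriv v t - deriv u t * v t = 1"
proof -
  let ?W = "\<lambda>t. u t * deriv v t - deriv u t * v t"
  have "(?W has_field_derivative 0) (at t within B)" if "t \<in> B" for t
  proof -
    have "(?W has_field_derivative
        (deriv u t * deriv v t + deriv (deriv v) t * u t) -
        (deriv (deriv u) t * v t + deriv v t * deriv u t)) (at t)"
      by (rule DERIV_diff[OF DERIV_mult[OF deriv_at[OF hol(1) that] deriv2_at[OF hol(2) that]]
            DERIV_mult[OF deriv2_at[OF hol(1) that] deriv_at[OF hol(2) that]]])
    moreover have "deriv (deriv u) t = - p t * u t" "deriv (deriv v) t = - p t * v t"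
      using ode_u[OF that] ode_v[OF that] by (simp_all add: add_eq_0_iff)
    ultimately have "(?W has_field_derivative 0) (at t)"
      by simp
    then show ?thesis
      by (rule has_field_derivative_at_within)
  qed
  then have "\<exists>k. \<forall>t\<in>B. ?W t = k"
    by (intro has_field_derivative_zero_constant[OF B(2)])
  then obtain k where k: "\<And>t. t \<in> B \<Longrightarrow> ?W t = k"
    by blast
  from k[OF t] k[OF B(3)] init show ?thesis
    by simp
qed

end

text \<open>One constant \<open>M\<close> dominates both solutions and the lengths of the
  integration segments, which turns all later estimates into monomials in \<open>M\<close>.\<close>

locale bounded_fundamental_system = fundamental_system +
  fixes M :: real
  assumes bound_u: "\<And>t. t \<in> B \<Longrightarrow> cmod (u t) \<le> M"
    and bound_v: "\<And>t. t \<in> B \<Longrightarrow> cmod (v t) \<le> M"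
    and bound_B: "\<And>t. t \<in> B \<Longrightarrow> cmod (t - t\<^sub>0) \<le> M"
begin

lemma M_nonneg: "0 \<le> M"
  using bound_u[OF B(3)] norm_ge_zero order_trans by blast

text \<open>This is the Volterra operator with kernel \<open>(u t * v s - v t * u s) * H s\<close>,
  that is, the solution operator for the right-hand side \<open>- H y\<close> with zero initial data
  at \<open>t\<^sub>0\<close>.\<close>

definition correction :: "(complex \<Rightarrow> complex) \<Rightarrow> (complex \<Rightarrow> complex) \<Rightarrow> complex \<Rightarrow> complex" where
  "correction H y t =
     u t * contour_integral (linepath t\<^sub>0 t) (\<lambda>s. v s * H s * y s) -
     v t * contour_integral (linepath t\<^sub>0 t) (\<lambda>s. u s * H s * y s)"

lemma primitive_at:
  assumes "f holomorphic_on B" "t \<in> B"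
  shows "((\<lambda>t. contour_integral (linepath t\<^sub>0 t) f) has_field_derivative f t) (at t)"
  by (rule linepath_primitive[OF B(1,2) assms(1) B(3) assms(2)])

lemma primitive_bound:
  assumes "f holomorphic_on B" "\<And>s. s \<in> B \<Longrightarrow> cmod (f s) \<le> N" "t \<in> B"
  shows "cmod (contour_integral (linepath t\<^sub>0 t) f) \<le> N * M"
proof -
  have "closed_segment t\<^sub>0 t \<subseteq> B"
    using B assms(3) closed_segment_subset by blast
  moreover have "0 \<le> N"
    using assms(2)[OF B(3)] norm_ge_zero order_trans by blast
  ultimately have "cmod (contour_integral (linepath t\<^sub>0 t) f) \<le> N * cmod (t - t\<^sub>0)"
    using assms B by (intro contour_integral_bound_linepath contour_integrable_linepath_holomorphic[of B]) auto
  also have "\<dots> \<le> N * M"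
    by (rule mult_left_mono[OF bound_B[OF assms(3)] \<open>0 \<le> N\<close>])
  finally show ?thesis .
qed

lemma holomorphic_correction:
  assumes H: "H holomorphic_on B" and y: "y holomorphic_on B"
  shows "correction H y holomorphic_on B"
proof -
  have prim: "(\<lambda>t. contour_integral (linepath t\<^sub>0 t) (\<lambda>s. w s * H s * y s)) holomorphic_on B"
    if "w holomorphic_on B" for w
  proof -
    have "(\<lambda>s. w s * H s * y s) holomorphic_on B"
      by (intro holomorphic_on_mult that H y)
    from primitive_at[OF this] show ?thesis
      unfolding holomorphic_on_open[OF B(1)] by blast
  qed
  show ?thesis
    unfolding correction_def
    by (intro holomorphic_on_diff holomorphic_on_mult hol prim)
qed

lemma correction_add:
  assumes "H holomorphic_on B" "f holomorphic_on B" "g holomorphic_on B" "t \<in> B"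
  shows "correction H (\<lambda>s. f s + g s) t = correction H f t + correction H g t"
proof -
  have *: "contour_integral (linepath t\<^sub>0 t) (\<lambda>s. w s * H s * (f s + g s)) =
      contour_integral (linepath t\<^sub>0 t) (\<lambda>s. w s * H s * f s) +
      contour_integral (linepath t\<^sub>0 t) (\<lambda>s. w s * H s * g s)" if "w holomorphic_on B" for w
    unfolding ring_distribs
    by (intro contour_integral_add contour_integrable_linepath_holomorphic[of B])
      (auto intro!: holomorphic_intros assms that B)
  show ?thesis
    unfolding correction_def *[OF hol(1)] *[OF hol(2)] by (simp add: distrib_left)
qed

text \<open>Each integral is at most \<open>M * \<eta> * N\<close> times the segment length, itself
  at most \<open>M\<close>; the outer factor contributes another \<open>M\<close>, and there are two
  such terms.\<close>

lemma correction_bound: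
  assumes "H holomorphic_on B" "y holomorphic_on B"
    and H: "\<And>s. s \<in> B \<Longrightarrow> cmod (H s) \<le> \<eta>" and y: "\<And>s. s \<in> B \<Longrightarrow> cmod (y s) \<le> N" and t: "t \<in> B"
  shows "cmod (correction H y t) \<le> 2 * M ^ 3 * \<eta> * N"
proof -
  have nn: "0 \<le> \<eta>" "0 \<le> N"
    using H[OF t] y[OF t] norm_ge_zero order_trans by blast+
  have *: "cmod (contour_integral (linepath t\<^sub>0 t) (\<lambda>s. w s * H s * y s)) \<le> M * \<eta> * N * M"
    if "w holomorphic_on B" "\<And>s. s \<in> B \<Longrightarrow> cmod (w s) \<le> M" for w
    by (rule primitive_bound)
      (auto intro!: holomorphic_intros mult_mono simp: assms that t norm_mult M_nonneg nn)
  have "cmod (correction H y t) \<le> M * (M * \<eta> * N * M) + M * (M * \<eta> * N * M)"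
    unfolding correction_def
    by (rule order_trans[OF norm_triangle_ineq4], unfold norm_mult)
      (intro add_mono mult_mono * hol bound_u bound_v t M_nonneg norm_ge_zero; assumption)
  then show ?thesis
    by (simp add: power3_eq_cube algebra_simps)
qed

text \<open>Variation of constants turns the perturbed equation into the fixed point equation
  \<open>y = y\<^sub>0 + correction H y\<close>.\<close>

lemma fixed_point_solution:
  assumes H: "H holomorphic_on B" and y0: "y\<^sub>0 holomorphic_on B" and y: "y holomorphic_on B"
    and ode: "\<And>t. t \<in> B \<Longrightarrow> deriv (deriv y\<^sub>0) t + p t * y\<^sub>0 t = 0"
    and fp: "\<And>t. t \<in> B \<Longrightarrow> y t = y\<^sub>0 t + correction H y t"
  shows "y t\<^sub>0 = y\<^sub>0 t\<^sub>0" "deriv y t\<^sub>0 = deriv y\<^sub>0 t\<^sub>0"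
    "\<And>t. t \<in> B \<Longrightarrow> deriv (deriv y) t + (p t + H t) * y t = 0"
proof -
  define a where "a t = contour_integral (linepath t\<^sub>0 t) (\<lambda>s. v s * H s * y s)" for t
  define b where "b t = contour_integral (linepath t\<^sub>0 t) (\<lambda>s. u s * H s * y s)" for t
  have a: "(a has_field_derivative v t * H t * y t) (at t)" if "t \<in> B" for t
    unfolding a_def by (rule primitive_at) (auto intro!: holomorphic_intros hol H y that)
  have b: "(b has_field_derivative u t * H t * y t) (at t)" if "t \<in> B" for t
    unfolding b_def by (rule primitive_at) (auto intro!: holomorphic_intros hol H y that)
  have yeq: "y t = y\<^sub>0 t + (u t * a t - v t * b t)" if "t \<in> B" for t
    using fp[OF that] by (simp add: correction_def a_def b_def)
  \<comment> \<open>Differentiating the integrals produces \<open>u v H y - v u H y = 0\<close>, so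
    the derivative has the same form as in variation of constants.\<close>
  have d1: "deriv y t = deriv y\<^sub>0 t + (deriv u t * a t - deriv v t * b t)" if "t \<in> B" for t
  proof -
    have "((\<lambda>t. y\<^sub>0 t + (u t * a t - v t * b t)) has_field_derivative
        deriv y\<^sub>0 t + (deriv u t * a t - deriv v t * b t)) (at t)"
      by (auto intro!: derivative_eq_intros deriv_at hol y0 a b that)
    then have "(y has_field_derivative deriv y\<^sub>0 t + (deriv u t * a t - deriv v t * b t)) (at t)"
      by (rule has_field_derivative_transform_within_open[OF _ B(1) that]) (simp add: yeq)
    then show ?thesis
      by (rule DERIV_imp_deriv)
  qed
  show "deriv (deriv y) t + (p t + H t) * y t = 0" if t: "t \<in> B" for t
  proof -
    \<comment> \<open>This time the terms from the integrals do not cancel: they form the Wronskian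
      times \<open>- H y\<close>, which is the perturbing term.\<close>
    have "((\<lambda>t. deriv y\<^sub>0 t + (deriv u t * a t - deriv v t * b t)) has_field_derivative
        deriv (deriv y\<^sub>0) t + (deriv (deriv u) t * a t - deriv (deriv v) t * b t)
          - (u t * deriv v t - deriv u t * v t) * H t * y t) (at t)"
      by (auto intro!: derivative_eq_intros deriv2_at hol y0 a b t simp: algebra_simps)
    then have "(deriv y has_field_derivative
        deriv (deriv y\<^sub>0) t + (deriv (deriv u) t * a t - deriv (deriv v) t * b t)
          - (u t * deriv v t - deriv u t * v t) * H t * y t) (at t)"
      by (rule has_field_derivative_transform_within_open[OF _ B(1) t]) (simp add: d1)
    then have "deriv (deriv y) t = deriv (deriv y\<^sub>0) t + (deriv (deriv u) t * a t - deriv (deriv v) t * b t)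
          - H t * y t"
      by (simp add: DERIV_imp_deriv wronskian t)
    moreover have "deriv (deriv u) t = - p t * u t" "deriv (deriv v) t = - p t * v t"
      "deriv (deriv y\<^sub>0) t = - p t * y\<^sub>0 t"
      using ode_u[OF t] ode_v[OF t] ode[OF t] by (simp_all add: add_eq_0_iff)
    ultimately show ?thesis
      by (simp add: yeq[OF t] algebra_simps)
  qed
  have "a t\<^sub>0 = 0" "b t\<^sub>0 = 0"
    by (simp_all add: a_def b_def)
  then show "y t\<^sub>0 = y\<^sub>0 t\<^sub>0" "deriv y t\<^sub>0 = deriv y\<^sub>0 t\<^sub>0"
    using yeq[OF B(3)] d1[OF B(3)] by simp_all
qed

text \<open>Smallness makes the contraction constant \<open>c\<close> at most 1/2, so
  \<open>y\<close> is bounded by \<open>2 * M\<close>. Inserting this into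
  \<open>correction_bound\<close> gives the first-order estimate \<open>4 * M ^ 4 * \<eta>\<close>,
  and inserting that estimate once more gives \<open>8 * M ^ 7 * \<eta>\<^sup>2\<close>.\<close>

lemma perturbed_solution:
  assumes H: "H holomorphic_on B" "\<And>s. s \<in> B \<Longrightarrow> cmod (H s) \<le> \<eta>" and small: "4 * M ^ 3 * \<eta> \<le> 1"
    and y0: "y\<^sub>0 holomorphic_on B" "\<And>t. t \<in> B \<Longrightarrow> deriv (deriv y\<^sub>0) t + p t * y\<^sub>0 t = 0"
      "\<And>t. t \<in> B \<Longrightarrow> cmod (y\<^sub>0 t) \<le> M"
  obtains y where "y holomorphic_on B" "y t\<^sub>0 = y\<^sub>0 t\<^sub>0" "deriv y t\<^sub>0 = deriv y\<^sub>0 t\<^sub>0"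
    "\<And>t. t \<in> B \<Longrightarrow> deriv (deriv y) t + (p t + H t) * y t = 0"
    "\<And>t. t \<in> B \<Longrightarrow> cmod (y t - y\<^sub>0 t) \<le> 4 * M ^ 4 * \<eta>"
    "\<And>t. t \<in> B \<Longrightarrow> cmod (y t - y\<^sub>0 t - correction H y\<^sub>0 t) \<le> 8 * M ^ 7 * \<eta>\<^sup>2"
proof -
  define c where "c = 2 * M ^ 3 * \<eta>"
  have "0 \<le> \<eta>"
    using H(2)[OF B(3)] norm_ge_zero order_trans by blast
  then have c: "0 \<le> c" "c \<le> 1 / 2" "c < 1"
    using small by (auto simp: c_def M_nonneg)
  obtain y where y: "y holomorphic_on B" "\<And>t. t \<in> B \<Longrightarrow> y t = y\<^sub>0 t + correction H y t"
    "\<And>t. t \<in> B \<Longrightarrow> cmod (y t) \<le> M / (1 - c)"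
  proof (rule holomorphic_neumann_series[of B "correction H" c y\<^sub>0 M])
    show "cmod (correction H f t) \<le> c * N"
      if "f holomorphic_on B" "\<And>s. s \<in> B \<Longrightarrow> cmod (f s) \<le> N" "t \<in> B" for f N t
      using correction_bound[OF H(1) that(1) H(2) that(2,3)] by (simp add: c_def)
  qed (use B(1) c(1,3) y0(1,3) holomorphic_correction[OF H(1)] correction_add[OF H(1)] in \<open>simp_all\<close>)
  have "M / (1 - c) \<le> 2 * M"
    using c M_nonneg mult_left_mono[of c "1/2" M] by (simp add: divide_simps algebra_simps)
  then have y2: "\<And>t. t \<in> B \<Longrightarrow> cmod (y t) \<le> 2 * M"
    using y(3) order_trans by blast
  have d1: "cmod (y t - y\<^sub>0 t) \<le> 4 * M ^ 4 * \<eta>" if "t \<in> B" for t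
    using correction_bound[OF H(1) y(1) H(2) y2 that] y(2)[OF that]
    by (simp add: eval_nat_numeral algebra_simps)
  have "cmod (y t - y\<^sub>0 t - correction H y\<^sub>0 t) \<le> 8 * M ^ 7 * \<eta>\<^sup>2" if t: "t \<in> B" for t
  proof -
    \<comment> \<open>By additivity the second-order error is the correction applied to the
      first-order error \<open>y - y\<^sub>0\<close>.\<close>
    have "correction H y t = correction H (\<lambda>s. y\<^sub>0 s + (y s - y\<^sub>0 s)) t"
      by simp
    also have "\<dots> = correction H y\<^sub>0 t + correction H (\<lambda>s. y s - y\<^sub>0 s) t"
      by (rule correction_add[OF H(1)]) (auto intro!: holomorphic_intros y y0 t)
    finally have "y t - y\<^sub>0 t - correction H y\<^sub>0 t = correction H (\<lambda>s. y s - y\<^sub>0 s) t"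
      using y(2)[OF t] by simp
    also have "cmod \<dots> \<le> 2 * M ^ 3 * \<eta> * (4 * M ^ 4 * \<eta>)"
      by (rule correction_bound[OF H(1) _ H(2) d1 t]) (auto intro!: holomorphic_intros y y0)
    finally show ?thesis
      by (simp add: eval_nat_numeral algebra_simps)
  qed
  moreover note fixed_point_solution[OF H(1) y0(1) y(1) y0(2) y(2)]
  ultimately show ?thesis
    using y(1) d1 by (intro that[of y]) auto
qed

end

section \<open>Taylor coefficients at the base point\<close>

text \<open>Cauchy's inequality on the circle of radius \<open>\<rho>\<close> bounds the derivative
  by a multiple of \<open>\<rho> ^ (n - k)\<close>, which tends to 0. Analyticity is what carries
  the punctured estimate over to the point \<open>a\<close> itself.\<close>

lemma higher_deriv_eq_0_of_bigo:
  fixes f :: "complex \<Rightarrow> complex"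
  assumes f: "f analytic_on {a}" and O: "f \<in> O[at a](\<lambda>t. (t - a) ^ n)" and k: "k < n"
  shows "(deriv ^^ k) f a = 0"
proof -
  obtain R where R: "R > 0" "f holomorphic_on ball a R"
    using f by (auto simp: analytic_on_def)
  obtain c where c: "c > 0" "\<forall>\<^sub>F t in at a. cmod (f t) \<le> c * cmod ((t - a) ^ n)"
    using landau_o.bigE[OF O] by blast
  then obtain d where d: "d > 0" "\<And>t. t \<noteq> a \<Longrightarrow> dist t a < d \<Longrightarrow> cmod (f t) \<le> c * cmod ((t - a) ^ n)"
    by (auto simp: eventually_at)
  have bound: "cmod ((deriv ^^ k) f a) \<le> fact k * c * \<rho> ^ (n - k)" if \<rho>: "0 < \<rho>" "\<rho> < min R d" for \<rho>
  proof -
    have "cmod ((deriv ^^ k) f a) \<le> fact k * (c * \<rho> ^ n) / \<rho> ^ k"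
    proof (rule Cauchy_inequality)
      show "f holomorphic_on ball a \<rho>"
        by (rule holomorphic_on_subset[OF R(2)]) (use \<rho> in auto)
      show "continuous_on (cball a \<rho>) f"
        by (rule continuous_on_subset[OF holomorphic_on_imp_continuous_on[OF R(2)]]) (use \<rho> in auto)
      show "cmod (f t) \<le> c * \<rho> ^ n" if "cmod (a - t) = \<rho>" for t
        using d(2)[of t] that \<rho> by (auto simp: dist_norm norm_power norm_minus_commute)
    qed (use \<rho> in auto)
    also have "\<dots> = fact k * c * \<rho> ^ (n - k)"
      using \<rho> k by (simp add: power_diff)
    finally show ?thesis .
  qed
  have ev: "\<forall>\<^sub>F \<rho> in at_right 0. cmod ((deriv ^^ k) f a) \<le> fact k * c * \<rho> ^ (n - k)"
    using eventually_at_right_real[of 0 "min R d"] R d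
    by (auto elim!: eventually_mono intro: bound)
  have lim: "((\<lambda>\<rho>. fact k * c * \<rho> ^ (n - k)) \<longlongrightarrow> fact k * c * 0 ^ (n - k)) (at_right (0::real))"
    by (intro tendsto_intros)
  show ?thesis
    using tendsto_lowerbound[OF lim ev] k by (simp add: zero_power)
qed

text \<open>The cubic estimate gives \<open>z\<close> the finite limit 0 at \<open>a\<close>, which
  excludes a pole, so that \<open>z\<close> is analytic there. The Taylor coefficients of
  \<open>z t - (t - a)\<close> below order three then vanish.\<close>

lemma schwarz_normalized_jet:
  assumes z: "z nicely_meromorphic_on A" "a \<in> A" and norm: "schwarz_normalized a z"
  shows "z analytic_on {a}" "z a = 0" "deriv z a = 1" "deriv (deriv z) a = 0"
proof -
  have O: "(\<lambda>t. z t - (t - a)) \<in> O[at a](\<lambda>t. (t - a) ^ 3)"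
    using norm by (simp add: schwarz_normalized_def)
  obtain c where c: "\<forall>\<^sub>F t in at a. norm (z t - (t - a)) \<le> c * norm ((t - a) ^ 3)"
    by (rule landau_o.bigE[OF O])
  have "((\<lambda>t. c * cmod ((t - a) ^ 3)) \<longlongrightarrow> c * cmod ((a - a) ^ 3)) (at a)"
    by (intro tendsto_mult tendsto_const tendsto_norm tendsto_power tendsto_diff tendsto_ident_at)
  then have c0: "((\<lambda>t. c * cmod ((t - a) ^ 3)) \<longlongrightarrow> 0) (at a)"
    by simp
  have lim: "((\<lambda>t. z t - (t - a)) \<longlongrightarrow> 0) (at a)"
    by (rule Lim_null_comparison[OF c c0])
  have "((\<lambda>t. t - a) \<longlongrightarrow> a - a) (at a)"
    by (intro tendsto_intros)
  from tendsto_add[OF lim this] have z0: "(z \<longlongrightarrow> 0) (at a)"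
    by simp
  have "\<not> is_pole z a"
    using not_tendsto_and_filterlim_at_infinity[OF at_neq_bot z0] by (auto simp: is_pole_def)
  then show an: "z analytic_on {a}"
    by (rule nicely_meromorphic_on_imp_analytic_at[OF z])
  then obtain R where R: "R > 0" "z holomorphic_on ball a R"
    by (auto simp: analytic_on_def)
  have "(\<lambda>t. z t - (t - a)) analytic_on {a}"
    by (intro analytic_intros an)
  from higher_deriv_eq_0_of_bigo[OF this O]
  have jet: "(deriv ^^ k) (\<lambda>t. z t - (t - a)) a = 0" if "k < 3" for k
    using that by blast
  have eq: "(deriv ^^ k) (\<lambda>t. z t - (t - a)) a = (deriv ^^ k) z a - (deriv ^^ k) (\<lambda>t. t - a) a" for k
    by (rule higher_deriv_diff[OF R(2)]) (use R in \<open>auto intro!: holomorphic_intros\<close>)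
  have lin: "deriv (\<lambda>t. t - a) = (\<lambda>_. 1)"
    by (rule ext, rule DERIV_imp_deriv) (auto intro!: derivative_eq_intros)
  show "z a = 0"
    using jet[of 0] by simp
  show "deriv z a = 1"
    using jet[of 1] eq[of 1] by (simp add: lin)
  show "deriv (deriv z) a = 0"
    using jet[of 2] eq[of 2] by (simp add: lin numeral_2_eq_2)
qed

section \<open>Riccati uniqueness and the representation of \<open>z\<close> as a quotient\<close>

text \<open>Integrating factor: with a primitive \<open>G\<close> of \<open>g\<close>, the product
  \<open>E t * exp (- G t)\<close> is constant, and it vanishes at \<open>a\<close>.\<close>

lemma linear_ode_first_order_zero:
  assumes D: "open D" "convex D" "a \<in> D" and g: "g holomorphic_on D"
    and E: "\<And>t. t \<in> D \<Longrightarrow> (E has_field_derivative g t * E t) (at t)" "E a = 0" and t: "t \<in> D"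
  shows "E t = 0"
proof -
  define G where "G t = contour_integral (linepath a t) g" for t
  have G: "(G has_field_derivative g t) (at t)" if "t \<in> D" for t
    unfolding G_def by (rule linepath_primitive[OF D(1,2) g D(3) that])
  have "((\<lambda>t. E t * exp (- G t)) has_field_derivative 0) (at t within D)" if "t \<in> D" for t
  proof (rule has_field_derivative_at_within)
    show "((\<lambda>t. E t * exp (- G t)) has_field_derivative 0) (at t)"
      by (auto intro!: derivative_eq_intros G E(1) that)
  qed
  then have "\<exists>k. \<forall>t\<in>D. E t * exp (- G t) = k"
    by (intro has_field_derivative_zero_constant[OF D(2)])
  then have "E t * exp (- G t) = E a * exp (- G a)"
    using t D(3) by auto
  then show ?thesis
    using E(2) by simp
qed

context fundamental_system
begin

text \<open>For \<open>E = z''/z' + 2u'/u\<close>, the Riccati equations of \<open>z''/z'\<close> and \<open>-2u'/u\<close> show that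
  \<open>E\<close> solves a homogeneous linear equation with \<open>E(t\<^sub>0) = 0\<close>. Hence \<open>z' = 1/u\<^sup>2 = (v/u)'\<close>.\<close>

lemma schwarz_solution_quotient_local:
  assumes BU: "B \<subseteq> unit_disk" and z: "schwarz_solution p z" "schwarz_normalized t\<^sub>0 z"
  obtains e where "e > 0" "ball t\<^sub>0 e \<subseteq> B" "\<And>t. t \<in> ball t\<^sub>0 e \<Longrightarrow> z t * u t = v t"
proof -
  have "z nicely_meromorphic_on unit_disk" "t\<^sub>0 \<in> unit_disk"
    using z BU B(3) by (auto simp: schwarz_solution_def)
  note jet = schwarz_normalized_jet[OF this z(2)]
  obtain e1 where e1: "e1 > 0" "z holomorphic_on ball t\<^sub>0 e1"
    using jet(1) by (auto simp: analytic_on_def)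
  obtain e2 where e2: "e2 > 0" "ball t\<^sub>0 e2 \<subseteq> B"
    using B open_contains_ball by blast
  have "continuous (at t\<^sub>0) u"
    using deriv_at[OF hol(1) B(3)] DERIV_isCont by blast
  then obtain e3 where e3: "e3 > 0" "\<And>t. dist t\<^sub>0 t < e3 \<Longrightarrow> u t \<noteq> 0"
    using continuous_at_avoid[of t\<^sub>0 u 0] init by auto
  \<comment> \<open>The three radii keep \<open>z\<close> holomorphic, the ball inside
    \<open>B\<close>, and \<open>u\<close> free of zeros.\<close>
  define e where "e = min e1 (min e2 e3)"
  define D where "D = ball t\<^sub>0 e"
  have D: "open D" "convex D" "t\<^sub>0 \<in> D" "D \<subseteq> B"
    using e1(1) e2 e3(1) by (auto simp: D_def e_def)
  have uD: "u t \<noteq> 0" if "t \<in> D" for t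
    using that e3(2) by (auto simp: D_def e_def)
  have zD: "z holomorphic_on D"
    by (rule holomorphic_on_subset[OF e1(2)]) (auto simp: D_def e_def)
  have z1: "(z has_field_derivative deriv z t) (at t)" if "t \<in> D" for t
    using zD D(1) holomorphic_derivI that by blast
  have z'D: "deriv z holomorphic_on D"
    by (rule holomorphic_deriv[OF zD D(1)])
  then have z2: "(deriv z has_field_derivative deriv (deriv z) t) (at t)" if "t \<in> D" for t
    using D(1) holomorphic_derivI that by blast
  have z''D: "deriv (deriv z) holomorphic_on D"
    by (rule holomorphic_deriv[OF z'D D(1)])
  have "deriv z t \<noteq> 0 \<and> schwarzian z t = 2 * p t" if "t \<in> D" for t
  proof -
    have "z analytic_on {t}"
      using zD D(1) that analytic_on_open[of D z] analytic_on_subset[of z D "{t}"] by blast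
    then show ?thesis
      using z(1) analytic_at_imp_no_pole that D(4) BU unfolding schwarz_solution_def by blast
  qed
  then have z'0: "\<And>t. t \<in> D \<Longrightarrow> deriv z t \<noteq> 0" and schwarz: "\<And>t. t \<in> D \<Longrightarrow> schwarzian z t = 2 * p t"
    by blast+
  have u1: "(u has_field_derivative deriv u t) (at t)" and v1: "(v has_field_derivative deriv v t) (at t)"
    and u2: "(deriv u has_field_derivative - p t * u t) (at t)" if "t \<in> D" for t
  proof -
    have tB: "t \<in> B" using that D(4) by blast
    show "(u has_field_derivative deriv u t) (at t)" "(v has_field_derivative deriv v t) (at t)"
      by (rule deriv_at[OF hol(1) tB] deriv_at[OF hol(2) tB])+
    have "deriv (deriv u) t = - p t * u t"
      using ode_u[OF tB] by (simp add: add_eq_0_iff)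
    then show "(deriv u has_field_derivative - p t * u t) (at t)"
      using deriv2_at[OF hol(1) tB] by simp
  qed
  define A where "A = (\<lambda>t. deriv (deriv z) t / deriv z t)"
  define E where "E = (\<lambda>t. A t + 2 * deriv u t / u t)"
  \<comment> \<open>Both \<open>A\<close> and \<open>w = - 2 u' / u\<close> satisfy
    \<open>w' = 2 p + w\<^sup>2 / 2\<close>. Subtracting gives
    \<open>(A - w)' = (A + w) / 2 * (A - w)\<close>; here \<open>E = A - w\<close> and
    \<open>g = (A + w) / 2\<close>.\<close>
  define g where "g = (\<lambda>t. (A t - 2 * deriv u t / u t) / 2)"
  have holA: "A holomorphic_on D"
    unfolding A_def by (intro holomorphic_on_divide z''D z'D z'0)
  have "u holomorphic_on D" "deriv u holomorphic_on D"
    using hol(1) holomorphic_deriv[OF hol(1) B(1)] D(4) holomorphic_on_subset by blast+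
  then have holg: "g holomorphic_on D"
    unfolding g_def by (intro holomorphic_intros holA uD) (auto simp: D(1))
  have A1: "(A has_field_derivative 2 * p t + (A t)\<^sup>2 / 2) (at t)" if "t \<in> D" for t
  proof -
    have "deriv A t = 2 * p t + (A t)\<^sup>2 / 2"
      using schwarz[OF that] by (simp add: schwarzian_def A_def diff_eq_eq)
    then show ?thesis
      using holomorphic_derivI[OF holA D(1) that] by simp
  qed
  have E1: "(E has_field_derivative g t * E t) (at t)" if "t \<in> D" for t
  proof -
    have "(E has_field_derivative 2 * p t + (A t)\<^sup>2 / 2 +
        (2 * (- p t * u t) * u t - 2 * deriv u t * deriv u t) / (u t * u t)) (at t)"
      unfolding E_def
      by (intro DERIV_add A1 DERIV_divide DERIV_cmult u1 u2 uD that)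
    moreover have "2 * p t + (A t)\<^sup>2 / 2 +
        (2 * (- p t * u t) * u t - 2 * deriv u t * deriv u t) / (u t * u t) = g t * E t"
      using uD[OF that] by (simp add: g_def E_def power2_eq_square field_simps)
    ultimately show ?thesis by simp
  qed
  have E0: "E t = 0" if "t \<in> D" for t
    by (rule linear_ode_first_order_zero[OF D(1-3) holg E1 _ that])
      (simp_all add: E_def A_def jet init)
  \<comment> \<open>The logarithmic derivative of \<open>z' u\<^sup>2\<close> is \<open>E\<close>,
    hence zero; the value at \<open>t\<^sub>0\<close> is 1.\<close>
  have "\<exists>k. \<forall>t\<in>D. deriv z t * (u t)\<^sup>2 = k"
  proof (rule has_field_derivative_zero_constant[OF D(2)])
    fix t assume t: "t \<in> D"
    have "((\<lambda>t. deriv z t * (u t)\<^sup>2) has_field_derivative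
        deriv (deriv z) t * (u t)\<^sup>2 + 2 * u t * deriv u t * deriv z t) (at t)"
      by (auto intro!: derivative_eq_intros z2 u1 t)
    moreover have "deriv (deriv z) t * (u t)\<^sup>2 + 2 * u t * deriv u t * deriv z t = deriv z t * (u t)\<^sup>2 * E t"
      using uD[OF t] z'0[OF t] by (simp add: E_def A_def power2_eq_square field_simps)
    ultimately show "((\<lambda>t. deriv z t * (u t)\<^sup>2) has_field_derivative 0) (at t within D)"
      using E0[OF t] by (simp add: has_field_derivative_at_within)
  qed
  then obtain k where k: "\<And>t. t \<in> D \<Longrightarrow> deriv z t * (u t)\<^sup>2 = k"
    by blast
  have z': "deriv z t = 1 / (u t)\<^sup>2" if "t \<in> D" for t
    using k[OF D(3)] k[OF that] uD[OF that] jet(3) init(1) by (simp add: eq_divide_eq)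
  \<comment> \<open>The Wronskian gives \<open>(v / u)' = 1 / u\<^sup>2\<close>, the same derivative
    as \<open>z\<close>; both functions vanish at \<open>t\<^sub>0\<close>.\<close>
  have "\<exists>k. \<forall>t\<in>D. z t - v t / u t = k"
  proof (rule has_field_derivative_zero_constant[OF D(2)])
    fix t assume t: "t \<in> D"
    have "((\<lambda>t. z t - v t / u t) has_field_derivative
        deriv z t - (deriv v t * u t - v t * deriv u t) / (u t * u t)) (at t)"
      by (intro DERIV_diff DERIV_divide z1 u1 v1 uD t)
    moreover have "deriv v t * u t - v t * deriv u t = 1"
      using wronskian[of t] t D(4) by (auto simp: mult.commute)
    ultimately show "((\<lambda>t. z t - v t / u t) has_field_derivative 0) (at t within D)"
      using z'[OF t] by (simp add: has_field_derivative_at_within power2_eq_square)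
  qed
  then obtain k' where k': "\<And>t. t \<in> D \<Longrightarrow> z t - v t / u t = k'"
    by blast
  have "z t * u t = v t" if "t \<in> D" for t
    using k'[OF D(3)] k'[OF that] uD[OF that] jet(2) init by (simp add: eq_divide_eq)
  moreover have "e > 0"
    using e1(1) e2(1) e3(1) by (simp add: e_def)
  ultimately show ?thesis
    using that[of e] D(4) by (auto simp: D_def)
qed

text \<open>Removing the sparse set of poles leaves \<open>B\<close> connected, so the local
  identity \<open>z u = v\<close> continues to all other points. At a pole \<open>u\<close> must
  vanish, since otherwise \<open>z\<close> would tend to \<open>v / u\<close>. Conversely, a zero of
  \<open>u\<close> that is not a pole would also be a zero of \<open>v\<close>, against the
  Wronskian.\<close>

lemma schwarz_solution_quotient:
  assumes BU: "B \<subseteq> unit_disk" and z: "schwarz_solution p z" "schwarz_normalized t\<^sub>0 z" and t: "t \<in> B"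
  shows "\<not> is_pole z t \<Longrightarrow> z t * u t = v t" and "is_pole z t \<longleftrightarrow> u t = 0"
proof -
  define P where "P = {t. is_pole z t}"
  define S where "S = B - P"
  have mero: "z nicely_meromorphic_on B"
    using z(1) BU nicely_meromorphic_on_subset by (auto simp: schwarz_solution_def)
  then have "\<forall>\<^sub>F t in cosparse B. \<not> is_pole z t"
    by (intro meromorphic_on_imp_not_pole_cosparse) (auto simp: nicely_meromorphic_on_def)
  then have sparse: "P sparse_in B"
    by (simp add: eventually_cosparse P_def)
  have S: "open S" "connected S"
    unfolding S_def
    using open_diff_sparse_pts[OF B(1) sparse] sparse_imp_connected[OF _ convex_connected[OF B(2)] B(1) sparse]
    by auto
  have zS: "z holomorphic_on S"
  proof -
    have "z analytic_on {t}" if "t \<in> S" for t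
      using that nicely_meromorphic_on_imp_analytic_at[OF mero] by (auto simp: S_def P_def)
    then have "z analytic_on S"
      using analytic_on_analytic_at by blast
    then show ?thesis
      by (rule analytic_imp_holomorphic)
  qed
  obtain e where e: "e > 0" "ball t\<^sub>0 e \<subseteq> B" "\<And>t. t \<in> ball t\<^sub>0 e \<Longrightarrow> z t * u t = v t"
    using schwarz_solution_quotient_local[OF BU z] by blast
  have eq: "z s * u s = v s" if "s \<in> S" for s
  proof -
    \<comment> \<open>The identity theorem is applied with the ball minus the poles, an open set
      containing \<open>t\<^sub>0\<close>, so that \<open>t\<^sub>0\<close> is a limit point of
      it.\<close>
    have "z s * u s - v s = 0"
    proof (rule analytic_continuation[of "\<lambda>s. z s * u s - v s" S "ball t\<^sub>0 e - P" t\<^sub>0])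
      show "(\<lambda>s. z s * u s - v s) holomorphic_on S"
        by (intro holomorphic_intros zS holomorphic_on_subset[OF hol(1)] holomorphic_on_subset[OF hol(2)])
          (auto simp: S_def)
      show "t\<^sub>0 \<in> S"
        using schwarz_normalized_jet(1)[OF mero B(3) z(2)] analytic_at_imp_no_pole B(3)
        by (auto simp: S_def P_def)
      then have "t\<^sub>0 \<in> ball t\<^sub>0 e - P" "open (ball t\<^sub>0 e - P)"
        using e(1) S(1) open_diff_sparse_pts[OF open_ball sparse_in_subset[OF sparse e(2)]]
        by (auto simp: S_def)
      then show "t\<^sub>0 islimpt ball t\<^sub>0 e - P"
        using interior_limit_point interior_open by blast
    qed (use S e that in \<open>auto simp: S_def\<close>)
    then show ?thesis by simp
  qed
  then have *: "z t * u t = v t" if "\<not> is_pole z t"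
    using that t by (simp add: S_def P_def)
  then show "\<not> is_pole z t \<Longrightarrow> z t * u t = v t" .
  show "is_pole z t \<longleftrightarrow> u t = 0"
  proof
    assume pole: "is_pole z t"
    show "u t = 0"
    proof (rule ccontr)
      assume ut: "u t \<noteq> 0"
      have cu: "isCont u t" and cv: "isCont v t"
        using deriv_at[OF hol(1) t] deriv_at[OF hol(2) t] DERIV_isCont by blast+
      have "\<forall>\<^sub>F s in at t. s \<in> S"
        using sparse t B(1) eventually_at_in_open'[OF B(1) t]
        by (auto simp: sparse_in_eventually_iff S_def elim: eventually_elim2)
      moreover have "\<forall>\<^sub>F s in at t. u s \<noteq> 0"
        using tendsto_imp_eventually_ne[OF isContD[OF cu] ut] .
      ultimately have "\<forall>\<^sub>F s in at t. v s / u s = z s"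
        by eventually_elim (simp add: eq[symmetric])
      moreover have "((\<lambda>s. v s / u s) \<longlongrightarrow> v t / u t) (at t)"
        by (intro tendsto_divide isContD cu cv ut)
      ultimately have lim: "(z \<longlongrightarrow> v t / u t) (at t)"
        by (rule Lim_transform_eventually[rotated])
      show False
        using pole not_tendsto_and_filterlim_at_infinity[OF at_neq_bot lim] by (auto simp: is_pole_def)
    qed
  next
    assume "u t = 0"
    then show "is_pole z t"
      using * wronskian[OF t] by fastforce
  qed
qed

end

section \<open>First-order expansion of the quotient\<close>

context bounded_fundamental_system
begin

text \<open>The right-hand side is the numerator of the first variation of \<open>v / u\<close>.
  Expanding the square on the left gives four integrals, and \<open>v t = z * u t\<close> matches
  their coefficients with those of the two corrections.\<close>

lemma correction_wronskian:
  assumes H: "H holomorphic_on B" and t: "t \<in> B" and ut: "u t \<noteq> 0" and z: "z = v t / u t"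
  shows "(u t)\<^sup>2 * contour_integral (linepath t\<^sub>0 t) (\<lambda>s. H s * (v s - z * u s)\<^sup>2) =
    u t * correction H v t - v t * correction H u t"
proof -
  let ?P = "\<lambda>f g. contour_integral (linepath t\<^sub>0 t) (\<lambda>s. f s * H s * g s)"
  have int: "(\<lambda>s. c * (f s * H s * g s)) contour_integrable_on (linepath t\<^sub>0 t)"
    if "f holomorphic_on B" "g holomorphic_on B" for f g c
    by (intro contour_integrable_linepath_holomorphic[OF B(2) _ B(3) t] holomorphic_on_mult
        holomorphic_on_const that H)
  have int1: "(\<lambda>s. f s * H s * g s) contour_integrable_on (linepath t\<^sub>0 t)"
    if "f holomorphic_on B" "g holomorphic_on B" for f g
    using int[OF that, of 1] by simp
  have "contour_integral (linepath t\<^sub>0 t) (\<lambda>s. H s * (v s - z * u s)\<^sup>2) =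
      contour_integral (linepath t\<^sub>0 t)
        (\<lambda>s. (v s * H s * v s - z * (u s * H s * v s)) - (z * (v s * H s * u s) - z\<^sup>2 * (u s * H s * u s)))"
    by (simp add: power2_eq_square algebra_simps)
  also have "\<dots> = (?P v v - z * ?P u v) - (z * ?P v u - z\<^sup>2 * ?P u u)"
    using hol by (simp only: contour_integral_diff contour_integral_lmul contour_integrable_diff int int1)
  finally have eq: "contour_integral (linepath t\<^sub>0 t) (\<lambda>s. H s * (v s - z * u s)\<^sup>2) =
      (?P v v - z * ?P u v) - (z * ?P v u - z\<^sup>2 * ?P u u)" .
  \<comment> \<open>With the four integrals abstracted to \<open>a\<close>, \<open>b\<close>,
    \<open>c\<close>, \<open>d\<close>, the claim is a polynomial identity.\<close>
  have "x\<^sup>2 * ((a - z * b) - (z * c - z\<^sup>2 * d)) = x * (x * a - w * b) - w * (x * c - w * d)"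
    if "w = z * x" for a b c d w x :: complex
    by (simp add: that power2_eq_square algebra_simps)
  note alg = this
  have "v t = z * u t"
    using ut by (simp add: z)
  then show ?thesis
    unfolding correction_def eq by (rule alg)
qed

text \<open>The numbers \<open>U\<close> and \<open>V\<close> are the perturbed values at
  \<open>t\<close>. Smallness gives \<open>|U| >= |u t| / 2\<close>; the first-order part of the
  quotient is the integral by \<open>correction_wronskian\<close>, and what remains has a numerator
  quadratic in \<open>\<eta>\<close>.\<close>

lemma quotient_expansion:
  assumes H: "H holomorphic_on B" "\<And>s. s \<in> B \<Longrightarrow> cmod (H s) \<le> \<eta>"
    and t: "t \<in> B" and ut: "u t \<noteq> 0" and z: "z = v t / u t"
    and U: "cmod (U - u t) \<le> 4 * M ^ 4 * \<eta>" "cmod (U - u t - correction H u t) \<le> 8 * M ^ 7 * \<eta>\<^sup>2"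
    and V: "cmod (V - v t - correction H v t) \<le> 8 * M ^ 7 * \<eta>\<^sup>2"
    and small: "4 * M ^ 4 * \<eta> \<le> cmod (u t) / 2"
  shows "U \<noteq> 0"
    and "cmod (V / U - (z + contour_integral (linepath t\<^sub>0 t) (\<lambda>s. H s * (v s - z * u s)\<^sup>2)))
      \<le> 64 * M ^ 9 / cmod (u t) ^ 3 * \<eta>\<^sup>2"
proof -
  define I where "I = contour_integral (linepath t\<^sub>0 t) (\<lambda>s. H s * (v s - z * u s)\<^sup>2)"
  define eu ev where "eu = U - u t - correction H u t" and "ev = V - v t - correction H v t"
  have \<eta>: "0 \<le> \<eta>"
    using H(2)[OF t] norm_ge_zero order_trans by blast
  have "cmod (u t) \<le> cmod U + cmod (U - u t)"
    using norm_triangle_sub[of "u t" U] by (simp add: norm_minus_commute)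
  then have Uge: "cmod (u t) / 2 \<le> cmod U"
    using U(1) small by linarith
  then show U0: "U \<noteq> 0"
    using ut by auto
  have I: "(u t)\<^sup>2 * I = u t * correction H v t - v t * correction H u t"
    unfolding I_def by (rule correction_wronskian[OF H(1) t ut z])
  have corr: "cmod (correction H v t) \<le> 2 * M ^ 3 * \<eta> * M" "cmod (correction H u t) \<le> 2 * M ^ 3 * \<eta> * M"
    by (rule correction_bound[OF H(1) hol(2) H(2) bound_v t] correction_bound[OF H(1) hol(1) H(2) bound_u t]; assumption)+
  have "cmod ((u t)\<^sup>2 * I) \<le> M * (2 * M ^ 3 * \<eta> * M) + M * (2 * M ^ 3 * \<eta> * M)"
    unfolding I
    by (rule order_trans[OF norm_triangle_ineq4], unfold norm_mult)
      (intro add_mono mult_mono corr bound_u bound_v t M_nonneg norm_ge_zero)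
  then have bI: "cmod ((u t)\<^sup>2 * I) \<le> 4 * M ^ 5 * \<eta>"
    by (simp add: eval_nat_numeral algebra_simps)
  \<comment> \<open>The numerator is multiplied by an extra \<open>u t\<close>, so that
    \<open>I\<close> occurs only in the combination \<open>(u t)\<^sup>2 * I\<close> bounded by
    \<open>bI\<close>.\<close>
  define X where "X = u t * (u t * ev - v t * eu) - (u t)\<^sup>2 * I * (U - u t)"
  have "V / U - (z + I) = (V * u t - v t * U - u t * U * I) / (u t * U)"
    using ut U0 by (simp add: z field_simps)
  \<comment> \<open>The first-order terms
    \<open>u t * correction H v t - v t * correction H u t\<close> equal
    \<open>(u t)\<^sup>2 * I\<close> and combine with \<open>- u t * U * I\<close>, leaving a
    product of two small factors.\<close>
  also have "V * u t - v t * U - u t * U * I = u t * ev - v t * eu - u t * I * (U - u t)"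
    using I by (simp add: eu_def ev_def power2_eq_square algebra_simps)
  also have "\<dots> / (u t * U) = X / ((u t)\<^sup>2 * U)"
    using ut U0 by (simp add: X_def power2_eq_square field_simps)
  finally have eq: "V / U - (z + I) = X / ((u t)\<^sup>2 * U)" .
  have "cmod X \<le> cmod (u t) * (cmod (u t) * cmod ev + cmod (v t) * cmod eu) +
      cmod ((u t)\<^sup>2 * I) * cmod (U - u t)"
    unfolding X_def
    by (rule order_trans[OF norm_triangle_ineq4], unfold norm_mult)
      (intro add_mono mult_left_mono order_trans[OF norm_triangle_ineq4] order_refl norm_ge_zero;
        simp add: norm_mult)
  also have "\<dots> \<le> M * (M * (8 * M ^ 7 * \<eta>\<^sup>2) + M * (8 * M ^ 7 * \<eta>\<^sup>2)) + (4 * M ^ 5 * \<eta>) * (4 * M ^ 4 * \<eta>)"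
    using U V[folded ev_def] U(2)[folded eu_def] bI bound_u[OF t] bound_v[OF t] M_nonneg \<eta>
    by (intro add_mono mult_mono) auto
  also have "\<dots> = 32 * M ^ 9 * \<eta>\<^sup>2"
    by (simp add: eval_nat_numeral algebra_simps)
  finally have X: "cmod X \<le> 32 * M ^ 9 * \<eta>\<^sup>2" .
  have "cmod (V / U - (z + I)) = cmod X / (cmod (u t) ^ 2 * cmod U)"
    by (simp add: eq norm_divide norm_mult norm_power)
  also have "\<dots> \<le> 32 * M ^ 9 * \<eta>\<^sup>2 / (cmod (u t) ^ 2 * (cmod (u t) / 2))"
    using ut Uge X M_nonneg by (intro frac_le mult_left_mono) auto
  also have "\<dots> = 64 * M ^ 9 / cmod (u t) ^ 3 * \<eta>\<^sup>2"
    by (simp add: eval_nat_numeral)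
  finally show "cmod (V / U - (z + contour_integral (linepath t\<^sub>0 t) (\<lambda>s. H s * (v s - z * u s)\<^sup>2)))
      \<le> 64 * M ^ 9 / cmod (u t) ^ 3 * \<eta>\<^sup>2"
    by (simp add: I_def)
qed

end

section \<open>The maximum norm and the remainder term\<close>

lemma norm_component_le_maxnorm: "cmod (h $ j) \<le> maxnorm (h :: complex ^ 'd::finite)"
  unfolding maxnorm_def by (intro Max_ge) auto

lemma maxnorm_nonneg: "0 \<le> maxnorm (h :: complex ^ 'd::finite)"
  by (rule order_trans[OF norm_ge_zero norm_component_le_maxnorm])

lemma maxnorm_le_norm: "maxnorm (h :: complex ^ 'd::finite) \<le> norm h"
  unfolding maxnorm_def by (intro Max.boundedI) (auto simp: Finite_Cartesian_Product.norm_nth_le)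

text \<open>The filter \<open>at 0\<close> on the vector type belongs to the Euclidean norm, which
  dominates \<open>maxnorm\<close>.\<close>

lemma maxnorm_tendsto_0: "((maxnorm :: complex ^ 'd::finite \<Rightarrow> real) \<longlongrightarrow> 0) (at 0)"
proof (rule tendsto_sandwich[OF _ _ tendsto_const])
  show "((norm :: complex ^ 'd \<Rightarrow> real) \<longlongrightarrow> 0) (at 0)"
    by (rule tendsto_norm_zero[OF tendsto_ident_at])
qed (simp_all add: maxnorm_nonneg maxnorm_le_norm)

lemma holomorphic_bounded_on_ball:
  assumes "f holomorphic_on unit_disk" "R < 1"
  shows "\<exists>C. \<forall>s\<in>ball 0 R. cmod (f s) \<le> C"
proof -
  have "cball 0 R \<subseteq> unit_disk"
    using assms(2) by auto
  then have "continuous_on (cball 0 R) f"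
    by (rule continuous_on_subset[OF holomorphic_on_imp_continuous_on[OF assms(1)]])
  then have "compact (f ` cball 0 R)"
    by (rule compact_continuous_image) simp
  from compact_imp_bounded[OF this] show ?thesis
    by (force simp: bounded_iff)
qed

lemma quadratic_expansion_imp_smallo:
  fixes E :: "complex ^ 'd::finite \<Rightarrow> complex"
  assumes "\<forall>\<^sub>F h in at 0. cmod (E h) \<le> K * (maxnorm h)\<^sup>2"
  shows "E \<in> o[at 0](\<lambda>h. complex_of_real (maxnorm h))"
proof (rule landau_o.smallI)
  fix c :: real assume "c > 0"
  have "((\<lambda>h::complex ^ 'd. K * maxnorm h) \<longlongrightarrow> K * 0) (at 0)"
    by (intro tendsto_mult tendsto_const maxnorm_tendsto_0)
  then have "\<forall>\<^sub>F h::complex ^ 'd in at 0. K * maxnorm h < c"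
    using order_tendstoD(2) \<open>c > 0\<close> by fastforce
  with assms show "\<forall>\<^sub>F h in at 0. cmod (E h) \<le> c * cmod (complex_of_real (maxnorm h))"
  proof eventually_elim
    case (elim h)
    have "K * (maxnorm h)\<^sup>2 \<le> c * maxnorm h"
      using mult_right_mono[OF less_imp_le[OF elim(2)] maxnorm_nonneg[of h]] by (simp add: power2_eq_square mult.assoc)
    then show ?case
      using elim(1) by (simp add: maxnorm_nonneg)
  qed
qed

section \<open>The variational formula\<close>

theorem theorem3p2:
  fixes \<Gamma> :: "(complex \<Rightarrow> complex) set" and g :: nat and t\<^sub>0 :: complex
    and r u v :: "complex \<Rightarrow> complex" and q :: "'d::finite \<Rightarrow> complex \<Rightarrow> complex"
  assumes "fuchsian_group \<Gamma>" and "acts_freely \<Gamma>"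
    and "compact_space (orbit_space \<Gamma>)"
    and "has_genus (orbit_space \<Gamma>) g" and "g \<ge> 2" and "CARD('d) = 3 * g - 3"
    and "t\<^sub>0 \<in> unit_disk"
    and "r \<in> quadratic_differentials \<Gamma>"
    and "qd_basis \<Gamma> q"
    and "linear_solution (potential r q 0) u" and "u t\<^sub>0 = 1" and "deriv u t\<^sub>0 = 0"
    and "linear_solution (potential r q 0) v" and "v t\<^sub>0 = 0" and "deriv v t\<^sub>0 = 1"
  shows "\<forall>\<^sub>F \<epsilon> in at_right (0::real). \<forall>z :: complex \<Rightarrow> complex ^ 'd \<Rightarrow> complex.
    (\<forall>h. maxnorm h < \<epsilon> \<longrightarrow>
       schwarz_solution (potential r q h) (\<lambda>t. z t h) \<and> schwarz_normalized t\<^sub>0 (\<lambda>t. z t h)) \<longrightarrow>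
    (\<forall>t\<in>unit_disk. \<not> is_pole (\<lambda>t. z t 0) t \<longrightarrow>
       (\<lambda>h. z t h - (z t 0 +
          (\<Sum>i\<in>UNIV. h $ i *
             contour_integral (linepath t\<^sub>0 t) (\<lambda>s. q i s * (v s - z t 0 * u s)\<^sup>2))))
       \<in> o[at 0](\<lambda>h. complex_of_real (maxnorm h)))"
\<comment> \<open>Every positive \<open>\<epsilon>\<close> works, because the filter
  \<open>at 0\<close> enforces any further smallness of \<open>h\<close>.\<close>
proof (rule eventually_mono[OF eventually_at_right_less[of 0]], intro allI impI ballI)
  fix \<epsilon> :: real and z :: "complex \<Rightarrow> complex ^ 'd \<Rightarrow> complex" and t :: complex
  assume \<epsilon>: "0 < \<epsilon>"
    and z: "\<forall>h. maxnorm h < \<epsilon> \<longrightarrow>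
       schwarz_solution (potential r q h) (\<lambda>t. z t h) \<and> schwarz_normalized t\<^sub>0 (\<lambda>t. z t h)"
    and t: "t \<in> unit_disk" and no_pole: "\<not> is_pole (\<lambda>t. z t 0) t"
  \<comment> \<open>The disk of radius \<open>R\<close> contains both \<open>t\<^sub>0\<close> and
    \<open>t\<close>, and its closure still lies in the unit disk, which yields uniform
    bounds.\<close>
  obtain R where R: "max (cmod t\<^sub>0) (cmod t) < R" "R < 1"
    using dense[of "max (cmod t\<^sub>0) (cmod t)" 1] t assms(7) by auto
  define B where "B = ball (0::complex) R"
  have nbhd: "open B" "convex B" "t\<^sub>0 \<in> B" "t \<in> B" "B \<subseteq> unit_disk"
    using R by (auto simp: B_def)
  have hol_u: "u holomorphic_on unit_disk" and hol_v: "v holomorphic_on unit_disk"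
    using assms(10,13) by (auto simp: linear_solution_def)
  have hol_q: "q j holomorphic_on unit_disk" for j
  proof -
    have "q j \<in> quadratic_differentials \<Gamma>"
      using assms(9) cfun.span_base[of "q j" "range q"] by (auto simp: qd_basis_def)
    then show ?thesis
      by (simp add: quadratic_differentials_def)
  qed
  note bounded = holomorphic_bounded_on_ball[OF _ R(2), folded B_def]
  obtain Cu where Cu: "\<And>s. s \<in> B \<Longrightarrow> cmod (u s) \<le> Cu"
    using bounded[OF hol_u] by blast
  obtain Cv where Cv: "\<And>s. s \<in> B \<Longrightarrow> cmod (v s) \<le> Cv"
    using bounded[OF hol_v] by blast
  have "\<exists>C. \<forall>s\<in>B. cmod (q j s) \<le> C" for j
    by (rule bounded[OF hol_q])
  then obtain Q where Q: "\<And>j s. s \<in> B \<Longrightarrow> cmod (q j s) \<le> Q j"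
    by metis
  define \<kappa> where "\<kappa> = sum Q UNIV"
  \<comment> \<open>The 2 bounds the distance between any two points of the unit disk.\<close>
  define M where "M = max 2 (max Cu Cv)"
  interpret bounded_fundamental_system B t\<^sub>0 "potential r q 0" u v M
  proof
    show "cmod (s - t\<^sub>0) \<le> M" if "s \<in> B" for s
      using norm_triangle_ineq4[of s t\<^sub>0] that nbhd(3) R(2) by (auto simp: B_def M_def)
    show "cmod (u s) \<le> M" "cmod (v s) \<le> M" if "s \<in> B" for s
      using Cu[OF that] Cv[OF that] by (auto simp: M_def)
    show "deriv (deriv u) s + potential r q 0 s * u s = 0" "deriv (deriv v) s + potential r q 0 s * v s = 0"
      if "s \<in> B" for s
      using assms(10,13) that nbhd(5) unfolding linear_solution_def by blast+
    show "u holomorphic_on B" "v holomorphic_on B"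
      by (rule holomorphic_on_subset[OF hol_u nbhd(5)] holomorphic_on_subset[OF hol_v nbhd(5)])+
  qed (fact nbhd assms)+
  define H where "H h s = (\<Sum>j\<in>UNIV. h $ j * q j s)" for h :: "complex ^ 'd" and s
  have pot: "potential r q h s = potential r q 0 s + H h s" for h s
    by (simp add: potential_def H_def)
  have hol_qB: "q j holomorphic_on B" for j
    by (rule holomorphic_on_subset[OF hol_q nbhd(5)])
  have hol_H: "H h holomorphic_on B" for h
    unfolding H_def by (intro holomorphic_on_sum holomorphic_on_mult holomorphic_on_const hol_qB)
  have H_bound: "cmod (H h s) \<le> \<kappa> * maxnorm h" if "s \<in> B" for h s
  proof -
    have "cmod (H h s) \<le> (\<Sum>j\<in>UNIV. maxnorm h * Q j)"
      unfolding H_def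
      by (rule sum_norm_le)
        (auto simp: norm_mult intro!: mult_mono norm_component_le_maxnorm Q that maxnorm_nonneg)
    then show ?thesis
      by (simp add: \<kappa>_def sum_distrib_left mult.commute)
  qed
  have max0: "maxnorm (0 :: complex ^ 'd) = 0"
    by (simp add: maxnorm_def)
  then have z0: "schwarz_solution (potential r q 0) (\<lambda>t. z t 0)" "schwarz_normalized t\<^sub>0 (\<lambda>t. z t 0)"
    using z \<epsilon> by auto
  have ut: "u t \<noteq> 0" and zt: "z t 0 = v t / u t"
    using schwarz_solution_quotient[OF nbhd(5) z0 nbhd(4)] no_pole by (auto simp: eq_divide_eq)
  \<comment> \<open>Linearity in the perturbation turns the sum over the basis into one integral
    with density \<open>H h\<close>, the form that \<open>quotient_expansion\<close>
    delivers.\<close>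
  have integral: "(\<Sum>i\<in>UNIV. h $ i * contour_integral (linepath t\<^sub>0 t) (\<lambda>s. q i s * (v s - z t 0 * u s)\<^sup>2)) =
      contour_integral (linepath t\<^sub>0 t) (\<lambda>s. H h s * (v s - z t 0 * u s)\<^sup>2)" for h
  proof -
    have int: "(\<lambda>s. q i s * (v s - z t 0 * u s)\<^sup>2) contour_integrable_on (linepath t\<^sub>0 t)" for i
      by (intro contour_integrable_linepath_holomorphic[OF nbhd(2) _ nbhd(3,4)] holomorphic_intros hol hol_qB)
    have "contour_integral (linepath t\<^sub>0 t) (\<lambda>s. H h s * (v s - z t 0 * u s)\<^sup>2) =
        contour_integral (linepath t\<^sub>0 t) (\<lambda>s. \<Sum>i\<in>UNIV. h $ i * (q i s * (v s - z t 0 * u s)\<^sup>2))"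
      by (simp add: H_def sum_distrib_right mult.assoc)
    also have "\<dots> = (\<Sum>i\<in>UNIV. contour_integral (linepath t\<^sub>0 t) (\<lambda>s. h $ i * (q i s * (v s - z t 0 * u s)\<^sup>2)))"
      by (rule contour_integral_sum) (simp_all add: contour_integrable_lmul int)
    finally show ?thesis
      by (simp add: contour_integral_lmul int)
  qed
  have small: "\<forall>\<^sub>F h::complex ^ 'd in at 0. c * (\<kappa> * maxnorm h) < d" if "d > 0" for c d
  proof -
    have "((\<lambda>h::complex ^ 'd. c * (\<kappa> * maxnorm h)) \<longlongrightarrow> c * (\<kappa> * 0)) (at 0)"
      by (intro tendsto_mult tendsto_const maxnorm_tendsto_0)
    then show ?thesis
      using order_tendstoD(2) that by fastforce
  qed
  \<comment> \<open>Three smallness conditions, with \<open>\<eta> = \<kappa> * maxnorm h\<close>: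
    \<open>z\<close> solves the Schwarz equation for \<open>h\<close>, the Neumann series contracts,
    and the perturbed \<open>U t\<close> stays away from 0.\<close>
  have "\<forall>\<^sub>F h::complex ^ 'd in at 0. maxnorm h < \<epsilon>"
    using order_tendstoD(2)[OF maxnorm_tendsto_0 \<epsilon>] .
  moreover have "\<forall>\<^sub>F h::complex ^ 'd in at 0. 4 * M ^ 3 * (\<kappa> * maxnorm h) < 1"
    by (rule small) simp
  moreover have "\<forall>\<^sub>F h::complex ^ 'd in at 0. 4 * M ^ 4 * (\<kappa> * maxnorm h) < cmod (u t) / 2"
    by (rule small) (use ut in simp)
  ultimately have "\<forall>\<^sub>F h in at 0. cmod (z t h - (z t 0 +
      contour_integral (linepath t\<^sub>0 t) (\<lambda>s. H h s * (v s - z t 0 * u s)\<^sup>2))) \<le>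
      64 * M ^ 9 / cmod (u t) ^ 3 * \<kappa>\<^sup>2 * (maxnorm h)\<^sup>2"
  proof eventually_elim
    case (elim h)
    note pert = perturbed_solution[OF hol_H[of h] H_bound less_imp_le[OF elim(2)]]
    obtain U where U: "U holomorphic_on B" "U t\<^sub>0 = u t\<^sub>0" "deriv U t\<^sub>0 = deriv u t\<^sub>0"
      "\<And>t. t \<in> B \<Longrightarrow> deriv (deriv U) t + (potential r q 0 t + H h t) * U t = 0"
      "\<And>t. t \<in> B \<Longrightarrow> cmod (U t - u t) \<le> 4 * M ^ 4 * (\<kappa> * maxnorm h)"
      "\<And>t. t \<in> B \<Longrightarrow> cmod (U t - u t - correction (H h) u t) \<le> 8 * M ^ 7 * (\<kappa> * maxnorm h)\<^sup>2"
      by (rule pert[OF _ hol(1) ode_u bound_u]) (assumption | rule that; assumption)+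
    obtain V where V: "V holomorphic_on B" "V t\<^sub>0 = v t\<^sub>0" "deriv V t\<^sub>0 = deriv v t\<^sub>0"
      "\<And>t. t \<in> B \<Longrightarrow> deriv (deriv V) t + (potential r q 0 t + H h t) * V t = 0"
      "\<And>t. t \<in> B \<Longrightarrow> cmod (V t - v t) \<le> 4 * M ^ 4 * (\<kappa> * maxnorm h)"
      "\<And>t. t \<in> B \<Longrightarrow> cmod (V t - v t - correction (H h) v t) \<le> 8 * M ^ 7 * (\<kappa> * maxnorm h)\<^sup>2"
      by (rule pert[OF _ hol(2) ode_v bound_v]) (assumption | rule that; assumption)+
    \<comment> \<open>The perturbed pair has the same initial data, so the quotient representation
      applies to it with the potential for \<open>h\<close>.\<close>
    interpret pert: fundamental_system B t\<^sub>0 "potential r q h" U V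
    proof
      show "deriv (deriv U) t + potential r q h t * U t = 0" "deriv (deriv V) t + potential r q h t * V t = 0"
        if "t \<in> B" for t
        using U(4)[OF that] V(4)[OF that] by (simp_all only: pot[of h])
    qed (use nbhd U(1-3) V(1-3) init in auto)
    note expansion = quotient_expansion[OF hol_H H_bound nbhd(4) ut zt U(5)[OF nbhd(4)] U(6)[OF nbhd(4)] V(6)[OF nbhd(4)] less_imp_le[OF elim(3)]]
    have zh: "schwarz_solution (potential r q h) (\<lambda>t. z t h)" "schwarz_normalized t\<^sub>0 (\<lambda>t. z t h)"
      using z elim(1) by auto
    \<comment> \<open>\<open>expansion(1)\<close> gives \<open>U t \<noteq> 0\<close>, which rules
      out a pole of the perturbed solution at \<open>t\<close> and permits the division.\<close>
    have "z t h = V t / U t"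
      using pert.schwarz_solution_quotient[OF nbhd(5) zh nbhd(4)] expansion(1) by (auto simp: eq_divide_eq)
    then show ?case
      using expansion(2) by (simp add: power_mult_distrib mult.assoc)
  qed
  then show "(\<lambda>h. z t h - (z t 0 +
      (\<Sum>i\<in>UNIV. h $ i * contour_integral (linepath t\<^sub>0 t) (\<lambda>s. q i s * (v s - z t 0 * u s)\<^sup>2))))
      \<in> o[at 0](\<lambda>h. complex_of_real (maxnorm h))"
    unfolding integral by (rule quadratic_expansion_imp_smallo)
qed

end
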